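(* Let $C_8=[c_0,\dots,c_7]$ be the $8$-cycle. Exactly $6891$ of the $2^{20}$ chord sets $X$ of $C_8$ leave an admissible attachment set alive, i.e. are such that some admissible set $S$ is not killed by $X$. All of these have $|X|\le 9$, and the numbers of them with $|X|=0,1,\dots,9$ are, respectively, $$1,\ 20,\ 170,\ 736,\ 1654,\ 2036,\ 1474,\ 632,\ 152,\ 16.$$ In particular, every chord set with at least $10$ chords kills all admissible sets.
   Context: Indices are modulo $8$. A chord of $C_8$ is a pair $c_ic_j$ of distinct vertices not adjacent on $C_8$ (there are $20$ of them), and a chord set $X$ is any subset of these $20$ chords (chord sets are counted as labelled, not up to symmetry). $C_8+X$ is the graph on $\{c_0,\dots,c_7\}$ whose edges are the $8$ edges of the cycle together with the chords in $X$. The admissible sets are the $20$ subsets of $\{c_0,\dots,c_7\}$ of the forms $\{c_i\}$ ($8$ of them), $\{c_i,c_{i+3}\}$ ($8$ of them) and $\{c_i,c_{i+4}\}$ ($4$ of them). A chord set $X$ kills $S$ if at least one of the following holds: (i) $C_8+X$ has a Hamiltonian path whose two ends both lie in $S$; (ii) for some vertex $w\notin S$, $C_8+X$ has at least two distinct Hamiltonian paths each having one end $w$ and the other end in $S$ (the ends in $S$ may be the same or different). Hamiltonian paths are regarded as undirected subgraphs. *)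

theory Defs
  imports Main
begin

text \<open>
  A (finite, simple, undirected) graph is a pair of a vertex set and a set of
  two-element edges; a subgraph is again such a pair.
\<close>

type_synonym 'a graph = "'a set \<times> 'a set set"

definition verts :: "'a graph \<Rightarrow> 'a set" where
  "verts G = fst G"

definition edges :: "'a graph \<Rightarrow> 'a set set" where
  "edges G = snd G"

definition path_graph :: "'a list \<Rightarrow> 'a graph" where
  "path_graph vs = (set vs, {{vs ! i, vs ! Suc i} | i. Suc i < length vs})"

text \<open>
  \<open>P\<close> is a Hamiltonian path of \<open>G\<close> with ends \<open>a\<close> and \<open>b\<close>. The path \<open>P\<close> is an undirected
  subgraph: a vertex sequence and its reversal give the same \<open>P\<close>, so the relation is
  symmetric in \<open>a\<close> and \<open>b\<close>, and counting paths means counting subgraphs.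
\<close>

definition hamiltonian_path :: "'a graph \<Rightarrow> 'a graph \<Rightarrow> 'a \<Rightarrow> 'a \<Rightarrow> bool" where
  "hamiltonian_path G P a b \<longleftrightarrow>
     (\<exists>vs. vs \<noteq> [] \<and> distinct vs \<and> P = path_graph vs \<and>
           verts P = verts G \<and> edges P \<subseteq> edges G \<and> hd vs = a \<and> last vs = b)"

text \<open>The vertex \<open>c\<^sub>i\<close> is represented by the natural number \<open>i < 8\<close>.\<close>

definition C8 :: "nat graph" where
  "C8 = ({..<8}, {{i, (i + 1) mod 8} | i. i < 8})"

definition chords :: "nat set set" where
  "chords = {{i, j} | i j. i \<in> verts C8 \<and> j \<in> verts C8 \<and> i \<noteq> j \<and> {i, j} \<notin> edges C8}"

definition add_chords :: "nat set set \<Rightarrow> nat graph" where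
  "add_chords X = (verts C8, edges C8 \<union> X)"

definition admissible :: "nat set set" where
  "admissible =
     {{i} | i. i < 8} \<union> {{i, (i + 3) mod 8} | i. i < 8} \<union> {{i, (i + 4) mod 8} | i. i < 8}"

definition kills :: "nat set set \<Rightarrow> nat set \<Rightarrow> bool" where
  "kills X S \<longleftrightarrow>
     (\<exists>P. \<exists>a\<in>S. \<exists>b\<in>S. hamiltonian_path (add_chords X) P a b) \<or>
     (\<exists>w \<in> verts C8 - S. \<exists>P Q. P \<noteq> Q \<and>
        (\<exists>a\<in>S. hamiltonian_path (add_chords X) P w a) \<and>
        (\<exists>b\<in>S. hamiltonian_path (add_chords X) Q w b))"

definition alive_chord_sets :: "nat set set set" where
  "alive_chord_sets = {X. X \<subseteq> chords \<and> (\<exists>S\<in>admissible. \<not> kills X S)}"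

end

theory Submission
  imports Defs
begin

text \<open>
  Call a set \<open>S\<close> alive under \<open>X\<close> if \<open>X\<close> does not kill it. Three observations reduce the count to a
  computation of moderate size.

  Killing is monotone in \<open>S\<close> (\<open>kills_mono_attachment\<close>), so some admissible set is alive iff some
  singleton \<open>{v}\<close> is (\<open>leaves_alive_iff\<close>), and \<open>{v}\<close> is alive iff the Hamiltonian paths of \<open>C\<^sub>8 + X\<close>
  with one end \<open>v\<close> have pairwise different other ends (\<open>kills_singleton_iff\<close>). For a given \<open>X\<close> this
  is decided by enumerating paths (\<open>kills_singleton_iff_extensions\<close>).

  Killing is monotone in \<open>X\<close> (\<open>kills_mono_chords\<close>), so the chord sets in question form a simplicial
  complex on the \<open>20\<close> chords, and it is invariant under rotation of the cycle
  (\<open>leaves_alive_image\<close>). A simplicial complex is given by its facets as well as by its minimal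
  non-faces. Up to rotation there are \<open>17\<close> minimal non-faces, with two to five chords each, and
  \<open>14\<close> facets. It is enough to check by path enumeration that the former kill every singleton
  (\<open>killer_not_leaves_alive\<close>) and that the latter leave \<open>{c\<^sub>0}\<close> alive (\<open>survivor_leaves_alive\<close>).

  What remains is pure set combinatorics, with no paths involved. Branching on whether a chord is
  taken or not cuts the chord sets that contain none of the non-faces into disjoint intervals. The
  largest member of each interval lies in one of the facets, which shows that the two lists
  describe the same complex (\<open>covered_sound\<close>), and adding up binomial coefficients over the intervals
  gives the number of faces of each size (\<open>card_avoiding\<close>).
\<close>

section \<open>Killing in terms of Hamiltonian vertex sequences\<close>

definition ham_lists :: "'a graph \<Rightarrow> 'a list set" where
  "ham_lists G = {vs. vs \<noteq> [] \<and> distinct vs \<and> set vs = verts G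
                    \<and> successively (\<lambda>x y. {x, y} \<in> edges G) vs}"

lemma hamiltonian_path_iff_ham_lists:
  "hamiltonian_path G P a b \<longleftrightarrow>
     (\<exists>vs\<in>ham_lists G. P = path_graph vs \<and> hd vs = a \<and> last vs = b)"
proof -
  have "edges (path_graph vs) \<subseteq> edges G \<longleftrightarrow> successively (\<lambda>x y. {x, y} \<in> edges G) vs" for vs
    unfolding successively_conv_nth by (auto simp: edges_def path_graph_def)
  moreover have "verts (path_graph vs) = set vs" for vs :: "'a list"
    by (simp add: verts_def path_graph_def)
  ultimately show ?thesis
    unfolding hamiltonian_path_def ham_lists_def by auto
qed

lemma edges_path_graph_Cons:
  "edges (path_graph (x # y # zs)) = insert {x, y} (edges (path_graph (y # zs)))"
proof -
  have "(\<exists>i. e = {(x # y # zs) ! i, (x # y # zs) ! Suc i} \<and> Suc i < length (x # y # zs)) \<longleftrightarrow>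
      e = {x, y} \<or> (\<exists>i. e = {(y # zs) ! i, (y # zs) ! Suc i} \<and> Suc i < length (y # zs))"
    (is "(\<exists>i. ?Q i) \<longleftrightarrow> _") for e
  proof -
    have "(\<exists>i. ?Q i) \<longleftrightarrow> ?Q 0 \<or> (\<exists>i. ?Q (Suc i))"
      by (metis not0_implies_Suc)
    then show ?thesis by simp
  qed
  then show ?thesis
    by (auto simp: edges_def path_graph_def)
qed

text \<open>
  A path graph together with one of its ends determines the vertex sequence: the first vertex
  lies on exactly one edge, which names the second vertex; deleting that edge leaves the path
  graph of the remaining sequence. So different paths with a common end are the same thing as
  different lists with a common head.
\<close>

lemma path_graph_determines_list:
  assumes "distinct vs" "distinct ws" "vs \<noteq> []" "ws \<noteq> []" "hd vs = hd ws"
    and "edges (path_graph vs) = edges (path_graph ws)"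
  shows "vs = ws"
  using assms
proof (induction vs arbitrary: ws rule: induct_list012)
  case (2 x)
  then show ?case 
    by (cases ws rule: remdups_adj.cases) (auto simp: edges_path_graph_Cons edges_def path_graph_def)
next
  case (3 x y zs)
  have edge_sub: "\<And>us e. e \<in> edges (path_graph us) \<Longrightarrow> e \<subseteq> set us"
    by (auto simp: edges_def path_graph_def)
  from 3 obtain y' zs' where ws: "ws = x # y' # zs'"
    by (cases ws rule: remdups_adj.cases) (auto simp: edges_path_graph_Cons edges_def path_graph_def)
  have off: "x \<notin> e" if "e \<in> edges (path_graph (y # zs)) \<or> e \<in> edges (path_graph (y' # zs'))" for e
    using that edge_sub[of e] 3(3,4) ws by fastforce
  have eq: "insert {x, y} (edges (path_graph (y # zs))) = insert {x, y'} (edges (path_graph (y' # zs')))"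
    using 3(8) unfolding ws edges_path_graph_Cons .
  have yy: "y = y'"
    using eq off by (metis doubleton_eq_iff insertE insertI1)
  have "edges (path_graph (y # zs)) = edges (path_graph (y' # zs'))"
    using eq off unfolding yy by (metis insert_ident insertI1)
  with 3 ws yy have "y # zs = y' # zs'"
    by (intro "3.IH"(2)) auto
  with ws show ?case by simp
qed auto

text \<open>
  For a singleton \<open>{v}\<close> only the second way of killing can occur, since the two ends of a path on
  eight vertices differ. Lists are read towards \<open>v\<close>, so the common end \<open>w\<close> is the head.
\<close>

lemma kills_singleton_iff:
  assumes "v \<in> verts C8"
  shows "kills X {v} \<longleftrightarrow> \<not> inj_on hd {vs \<in> ham_lists (add_chords X). last vs = v}"
proof -
  let ?H = "ham_lists (add_chords X)"
  have ends: "hd vs \<in> verts C8" "hd vs \<noteq> last vs" if "vs \<in> ?H" for vs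
  proof -
    have vs: "vs \<noteq> []" "distinct vs" "set vs = {..<8}"
      using that by (auto simp: ham_lists_def add_chords_def verts_def C8_def)
    then have "length vs = 8" by (metis card_lessThan distinct_card)
    with vs show "hd vs \<noteq> last vs"
      by (simp add: hd_conv_nth last_conv_nth nth_eq_iff_index_eq)
    show "hd vs \<in> verts C8"
      using hd_in_set[OF vs(1)] vs(3) by (simp add: verts_def C8_def)
  qed
  show ?thesis
  proof
    assume "kills X {v}"
    then consider P where "hamiltonian_path (add_chords X) P v v"
      | w P Q where "P \<noteq> Q" "hamiltonian_path (add_chords X) P w v"
          "hamiltonian_path (add_chords X) Q w v"
      unfolding kills_def by blast
    then show "\<not> inj_on hd {vs \<in> ?H. last vs = v}"
    proof cases
      case 1
      then show ?thesis using ends(2) unfolding hamiltonian_path_iff_ham_lists by metis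
    next
      case 2
      then obtain vs ws where "vs \<in> ?H" "ws \<in> ?H" "vs \<noteq> ws" "hd vs = hd ws" "last vs = v" "last ws = v"
        unfolding hamiltonian_path_iff_ham_lists by blast
      then show ?thesis unfolding inj_on_def by blast
    qed
  next
    assume "\<not> inj_on hd {vs \<in> ?H. last vs = v}"
    then obtain vs ws where *: "vs \<in> ?H" "ws \<in> ?H" "vs \<noteq> ws" "hd vs = hd ws"
        "last vs = v" "last ws = v"
      unfolding inj_on_def by blast
    have "path_graph vs \<noteq> path_graph ws"
    proof
      assume "path_graph vs = path_graph ws"
      moreover have "distinct vs" "distinct ws" "vs \<noteq> []" "ws \<noteq> []"
        using *(1,2) by (simp_all add: ham_lists_def)
      ultimately show False using path_graph_determines_list[of vs ws] *(3,4) by simp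
    qed
    moreover have "hamiltonian_path (add_chords X) (path_graph vs) (hd vs) v"
      unfolding hamiltonian_path_iff_ham_lists using *(1,5) by (intro bexI[of _ vs]) simp_all
    moreover have "hamiltonian_path (add_chords X) (path_graph ws) (hd vs) v"
      unfolding hamiltonian_path_iff_ham_lists using *(2,4,6) by (intro bexI[of _ ws]) simp_all
    moreover have "hd vs \<in> verts C8 - {v}" using ends[OF *(1)] *(5) by simp
    ultimately show "kills X {v}"
      unfolding kills_def by blast
  qed
qed

text \<open>
  Killing is monotone in the attachment set: two paths from \<open>w\<close> to \<open>v\<close> still do the job for a
  larger set \<open>S\<close> if \<open>w\<close> is outside \<open>S\<close>, and if \<open>w\<close> is inside then one of them has both ends in \<open>S\<close>.
\<close>

lemma kills_mono_attachment:
  assumes "kills X {v}" "v \<in> S"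
  shows "kills X S"
proof (cases "\<exists>w\<in>S. \<exists>P. hamiltonian_path (add_chords X) P w v")
  case True
  then show ?thesis using assms(2) by (auto simp: kills_def)
next
  case False
  with assms show ?thesis unfolding kills_def by blast
qed

text \<open>
  By the monotonicity just proved, the admissible sets with two elements can be forgotten: if one
  of them is alive, so are its singletons.
\<close>

definition leaves_alive :: "nat set set \<Rightarrow> bool" where
  "leaves_alive X \<longleftrightarrow> (\<exists>v\<in>verts C8. \<not> kills X {v})"

lemma leaves_alive_iff: "(\<exists>S\<in>admissible. \<not> kills X S) \<longleftrightarrow> leaves_alive X"
proof
  assume "\<exists>S\<in>admissible. \<not> kills X S"
  then obtain S where S: "S \<in> admissible" "\<not> kills X S" by blast
  then obtain v where "v \<in> S" "v < 8" unfolding admissible_def by auto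
  with S show "leaves_alive X"
    unfolding leaves_alive_def using kills_mono_attachment[of X v S] by (auto simp: verts_def C8_def)
next
  assume "leaves_alive X"
  then show "\<exists>S\<in>admissible. \<not> kills X S"
    unfolding leaves_alive_def admissible_def by (auto simp: verts_def C8_def)
qed

lemma kills_mono_chords:
  assumes "kills X S" "X \<subseteq> Y"
  shows "kills Y S"
proof -
  have "hamiltonian_path (add_chords Y) P a b" if "hamiltonian_path (add_chords X) P a b" for P a b
    using that assms(2) unfolding hamiltonian_path_def add_chords_def edges_def verts_def by fastforce
  then show ?thesis using assms(1) unfolding kills_def by blast
qed

lemma leaves_alive_antimono: "leaves_alive Y \<Longrightarrow> X \<subseteq> Y \<Longrightarrow> leaves_alive X"
  unfolding leaves_alive_def using kills_mono_chords by blast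

section \<open>Symmetries of the cycle\<close>

definition cycle_symmetry :: "(nat \<Rightarrow> nat) \<Rightarrow> bool" where
  "cycle_symmetry f \<longleftrightarrow> bij_betw f (verts C8) (verts C8) \<and> (\<forall>e\<in>edges C8. f ` e \<in> edges C8)"

text \<open>
  A symmetry maps cycle edges to cycle edges, so it carries Hamiltonian paths, and hence killing,
  forwards. Aliveness is thereby carried backwards; the forward direction will come from the
  inverse symmetry.
\<close>

lemma kills_image:
  assumes f: "cycle_symmetry f" and "kills X {v}" "v \<in> verts C8"
  shows "kills ((`) f ` X) {f v}"
proof -
  let ?H = "\<lambda>X. ham_lists (add_chords X)"
  have inj: "inj_on f {..<8}" and im: "f ` {..<8} = {..<8}"
    using f by (auto simp: cycle_symmetry_def bij_betw_def verts_def C8_def)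
  have map_H: "map f vs \<in> ?H ((`) f ` X)" if "vs \<in> ?H X" for vs
  proof -
    have "{f x, f y} \<in> edges C8 \<union> (`) f ` X" if "{x, y} \<in> edges C8 \<union> X" for x y
    proof -
      have "f ` {x, y} \<in> edges C8 \<union> (`) f ` X"
        using f that unfolding cycle_symmetry_def by blast
      then show ?thesis by simp
    qed
    then have "successively (\<lambda>x y. {f x, f y} \<in> edges C8 \<union> (`) f ` X) vs"
      using that by (auto simp: ham_lists_def add_chords_def edges_def elim!: successively_mono)
    then show ?thesis
      using that inj im
      by (simp add: ham_lists_def add_chords_def verts_def edges_def C8_def distinct_map
            successively_map)
  qed
  from assms(2,3) obtain vs ws where *: "vs \<in> ?H X" "ws \<in> ?H X" "vs \<noteq> ws" "hd vs = hd ws"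
      "last vs = v" "last ws = v"
    by (auto simp: kills_singleton_iff inj_on_def)
  moreover have "set vs = {..<8}" "set ws = {..<8}" "vs \<noteq> []" "ws \<noteq> []"
    using * by (auto simp: ham_lists_def add_chords_def verts_def C8_def)
  ultimately have "map f vs \<noteq> map f ws" "hd (map f vs) = hd (map f ws)"
      "last (map f vs) = f v" "last (map f ws) = f v"
    using inj by (auto simp: hd_map last_map inj_on_map_eq_map)
  moreover have "f v \<in> verts C8"
    using f assms(3) by (auto simp: cycle_symmetry_def bij_betw_def)
  ultimately show ?thesis
    using map_H[OF *(1)] map_H[OF *(2)] unfolding kills_singleton_iff[OF \<open>f v \<in> verts C8\<close>] inj_on_def
    by blast
qed

lemma leaves_alive_image:
  assumes "cycle_symmetry f" "leaves_alive ((`) f ` X)"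
  shows "leaves_alive X"
proof -
  from assms(2) obtain u where u: "u \<in> verts C8" "\<not> kills ((`) f ` X) {u}"
    unfolding leaves_alive_def by blast
  moreover have "f ` verts C8 = verts C8"
    using assms(1) by (simp add: cycle_symmetry_def bij_betw_def)
  ultimately obtain v where "v \<in> verts C8" "u = f v"
    by blast
  with u kills_image[OF assms(1), of X v] show ?thesis
    unfolding leaves_alive_def by blast
qed

section \<open>Enumerating Hamiltonian paths\<close>

definition edge_set :: "('a \<times> 'a) set \<Rightarrow> 'a set set" where
  "edge_set A = (\<lambda>(a, b). {a, b}) ` A"

lemma doubleton_in_edge_set: "{x, y} \<in> edge_set A \<longleftrightarrow> (x, y) \<in> A \<or> (y, x) \<in> A"
  by (fastforce simp: edge_set_def doubleton_eq_iff)

definition cycle_pairs :: "(nat \<times> nat) list" where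
  "cycle_pairs = [(0, 1), (1, 2), (2, 3), (3, 4), (4, 5), (5, 6), (6, 7), (7, 0)]"

lemma less_8: "{..<8 :: nat} = {0, 1, 2, 3, 4, 5, 6, 7}"
  by (auto simp: lessThan_nat_numeral lessThan_Suc)

lemma edges_C8: "edges C8 = edge_set (set cycle_pairs)"
proof -
  have "edges C8 = (\<lambda>i. {i, (i + 1) mod 8}) ` {..<8}"
    by (auto simp: edges_def C8_def)
  then show ?thesis
    by (simp add: less_8 edge_set_def cycle_pairs_def flip: numeral_2_eq_2)
qed

definition neighbours :: "('a \<times> 'a) list \<Rightarrow> 'a \<Rightarrow> 'a list" where
  "neighbours E v = remdups (concat (map (\<lambda>(a, b).
     (if a = v then [b] else []) @ (if b = v then [a] else [])) E))"

text \<open>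
  All simple paths that arise from the path \<open>p\<close> by adding \<open>n\<close> vertices in front of its head.
\<close>

fun extensions :: "('a \<times> 'a) list \<Rightarrow> nat \<Rightarrow> 'a list \<Rightarrow> 'a list list" where
  "extensions E 0 p = [p]"
| "extensions E (Suc n) p =
     concat (map (\<lambda>w. extensions E n (w # p)) (filter (\<lambda>w. w \<notin> set p) (neighbours E (hd p))))"

lemma set_neighbours: "set (neighbours E v) = {w. {w, v} \<in> edge_set (set E)}"
  by (fastforce simp: neighbours_def doubleton_in_edge_set split: if_splits)

lemma set_extensions:
  fixes E :: "('a \<times> 'a) list"
  defines "walk \<equiv> \<lambda>vs. distinct vs \<and> successively (\<lambda>x y. {x, y} \<in> edge_set (set E)) vs"
  assumes "p \<noteq> []" "walk p"
  shows "set (extensions E n p) = {q @ p | q. length q = n \<and> walk (q @ p)}"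
  using assms(2,3)
proof (induction n arbitrary: p)
  case (Suc n)
  let ?W = "{w. w \<notin> set p \<and> {w, hd p} \<in> edge_set (set E)}"
  have walk_Cons: "walk (w # p) \<longleftrightarrow> w \<in> ?W" for w
    using Suc.prems by (auto simp: walk_def successively_Cons)
  have walk_suffix: "walk p'" if "walk (q @ p')" for q p'
    using that by (auto simp: walk_def successively_append_iff)
  have "set (extensions E (Suc n) p) = (\<Union>w\<in>?W. set (extensions E n (w # p)))"
    by (auto simp: set_neighbours)
  also have "\<dots> = (\<Union>w\<in>?W. {q @ w # p | q. length q = n \<and> walk (q @ w # p)})"
    using Suc.IH[of "_ # p"] walk_Cons by auto
  also have "\<dots> = {q @ p | q. length q = Suc n \<and> walk (q @ p)}" (is "?A = ?B")
  proof
    show "?A \<subseteq> ?B"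
    proof
      fix vs assume "vs \<in> ?A"
      then obtain w q where "vs = q @ w # p" "length q = n" "walk (q @ w # p)" by blast
      then show "vs \<in> ?B" by (auto intro!: exI[of _ "q @ [w]"])
    qed
    show "?B \<subseteq> ?A"
    proof
      fix vs assume "vs \<in> ?B"
      then obtain q where q: "vs = q @ p" "length q = Suc n" "walk (q @ p)" by blast
      then obtain q' w where "q = q' @ [w]" by (metis length_0_conv nat.distinct(1) rev_exhaust)
      with q walk_suffix[of q' "w # p"] walk_Cons show "vs \<in> ?A" by auto
    qed
  qed
  finally show ?case .
qed simp

lemma distinct_concat_map:
  assumes "distinct xs" "\<And>x. x \<in> set xs \<Longrightarrow> distinct (f x)"
    and "\<And>x y. x \<in> set xs \<Longrightarrow> y \<in> set xs \<Longrightarrow> x \<noteq> y \<Longrightarrow> set (f x) \<inter> set (f y) = {}"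
  shows "distinct (concat (map f xs))"
  using assms
proof (induction xs)
  case (Cons x xs)
  have "distinct (concat (map f xs))"
    using Cons.prems by (intro Cons.IH) simp_all
  moreover have "set (f x) \<inter> set (f y) = {}" if "y \<in> set xs" for y
    using Cons.prems(1) that by (intro Cons.prems(3)) auto
  then have "set (f x) \<inter> set (concat (map f xs)) = {}" by auto
  ultimately show ?case using Cons.prems(2)[of x] by simp
qed simp

text \<open>
  Without repetitions in the enumeration, a repeated head among the listed paths
  can be read as two different paths with the same end.
\<close>

lemma distinct_extensions: "distinct (extensions E n p)"
proof (induction n arbitrary: p)
  case (Suc n)
  have drop_ext: "vs \<in> set (extensions E m q) \<Longrightarrow> drop m vs = q" for vs m q
  proof (induction m arbitrary: q)
    case (Suc m)
    then obtain w where "drop m vs = w # q" by auto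
    then show ?case by (metis drop_Suc tl_drop list.sel(3))
  qed simp
  show ?case
    unfolding extensions.simps
  proof (rule distinct_concat_map)
    fix x y :: 'a assume "x \<noteq> y"
    then show "set (extensions E n (x # p)) \<inter> set (extensions E n (y # p)) = {}"
      by (auto dest!: drop_ext)
  qed (simp_all add: Suc.IH neighbours_def)
qed simp

lemma ham_lists_add_chords:
  "ham_lists (add_chords X) = {vs. vs \<noteq> [] \<and> distinct vs \<and> set vs = {..<8} \<and>
     successively (\<lambda>x y. {x, y} \<in> edges C8 \<union> X) vs}"
proof -
  have "verts (add_chords X) = {..<8}" "edges (add_chords X) = edges C8 \<union> X"
    by (simp_all add: add_chords_def verts_def edges_def C8_def)
  then show ?thesis by (simp add: ham_lists_def)
qed

text \<open>
  The extensions of \<open>[v]\<close> by seven vertices are the Hamiltonian paths that end in \<open>v\<close>, so killing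
  of a singleton becomes a question that rewriting can decide.
\<close>

lemma kills_singleton_iff_extensions:
  assumes "set L \<subseteq> {..<8} \<times> {..<8}" "v < 8"
  shows "kills (edge_set (set L)) {v} \<longleftrightarrow> \<not> distinct (map hd (extensions (cycle_pairs @ L) 7 [v]))"
proof -
  let ?E = "edge_set (set (cycle_pairs @ L))"
  have E: "edges C8 \<union> edge_set (set L) = ?E"
    by (simp add: edges_C8 edge_set_def image_Un)
  have range: "a < 8 \<and> b < 8" if "{a, b} \<in> ?E" for a b
    using that assms(1) by (auto simp: edge_set_def cycle_pairs_def doubleton_eq_iff)
  have below: "set (q @ [v]) \<subseteq> {..<8}"
    if "successively (\<lambda>x y. {x, y} \<in> ?E) (q @ [v])" for q
    using that
  proof (induction q)
    case (Cons a q)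
    then show ?case using range[of a "hd (q @ [v])"] by (simp add: successively_Cons)
  qed (simp add: assms(2))
  have "{vs \<in> ham_lists (add_chords (edge_set (set L))). last vs = v}
      = {q @ [v] | q. length q = 7 \<and> distinct (q @ [v]) \<and> successively (\<lambda>x y. {x, y} \<in> ?E) (q @ [v])}"
    (is "?H = ?Q")
  proof
    show "?H \<subseteq> ?Q"
    proof
      fix vs assume "vs \<in> ?H"
      then have vs: "vs \<noteq> []" "distinct vs" "set vs = {..<8}" "last vs = v"
          "successively (\<lambda>x y. {x, y} \<in> ?E) vs"
        unfolding ham_lists_add_chords E by simp_all
      then have "length vs = 8" by (metis card_lessThan distinct_card)
      then have "length (butlast vs) = 7" by simp
      moreover have "butlast vs @ [v] = vs" using vs(1,4) by (metis append_butlast_last_id)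
      ultimately show "vs \<in> ?Q"
        using vs(2,5) by (intro CollectI exI[of _ "butlast vs"]) simp
    qed
    show "?Q \<subseteq> ?H"
    proof
      fix vs assume "vs \<in> ?Q"
      then obtain q where q: "vs = q @ [v]" "length q = 7" "distinct vs"
          "successively (\<lambda>x y. {x, y} \<in> ?E) vs" by blast
      then have "card (set vs) = 8" by (simp add: distinct_card)
      then have "set vs = {..<8}"
        using below[of q] q by (intro card_subset_eq) simp_all
      with q show "vs \<in> ?H"
        unfolding ham_lists_add_chords E by simp
    qed
  qed
  also have "\<dots> = set (extensions (cycle_pairs @ L) 7 [v])"
    by (subst set_extensions) simp_all
  finally show ?thesis
    using assms(2) kills_singleton_iff[of v "edge_set (set L)"]
    by (simp add: distinct_map distinct_extensions verts_def C8_def)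
qed

section \<open>Families that avoid forbidden sets\<close>

text \<open>
  Binomial coefficients by addition alone, which suits evaluation by rewriting: the executable
  form of \<open>choose\<close> goes through factorials, and \<open>int\<close> has binary numerals where \<open>nat\<close> is unary.
\<close>

fun pascal :: "nat \<Rightarrow> nat \<Rightarrow> int" where
  "pascal n 0 = 1"
| "pascal 0 (Suc k) = 0"
| "pascal (Suc n) (Suc k) = pascal n k + pascal n (Suc k)"

lemma pascal_eq_binomial: "pascal n k = int (n choose k)"
  by (induction n k rule: pascal.induct) simp_all

text \<open>
  \<open>avoiding cs I R\<close> consists of the sets between \<open>I\<close> and \<open>I \<union> R\<close> that contain none of the forbidden
  sets in \<open>cs\<close>: the elements of \<open>I\<close> have been chosen, and those of \<open>R\<close> are still undecided.
  Forbidden sets are kept relative to \<open>I\<close>, that is, without the elements already chosen.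
\<close>

definition avoiding :: "'a list list \<Rightarrow> 'a list \<Rightarrow> 'a list \<Rightarrow> 'a set set" where
  "avoiding cs I R = {Y. set I \<subseteq> Y \<and> Y \<subseteq> set I \<union> set R \<and> (\<forall>c\<in>set cs. \<not> set c \<subseteq> Y)}"

text \<open>
  If \<open>x\<close> is left out, the forbidden sets through \<open>x\<close> are harmless; if \<open>x\<close> is chosen, they shrink.
  The shrunk sets are moved to the front, so that the branching below soon finishes or refutes
  them; without this the search is several times larger.
\<close>

definition omit :: "'a \<Rightarrow> 'a list list \<Rightarrow> 'a list list" where
  "omit x cs = filter (\<lambda>c. x \<notin> set c) cs"

definition contract :: "'a \<Rightarrow> 'a list list \<Rightarrow> 'a list list" where
  "contract x cs = map (removeAll x) (filter (\<lambda>c. x \<in> set c) cs) @ omit x cs"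

lemma avoiding_split:
  assumes "x \<in> set R" "x \<notin> set I"
  shows "avoiding cs I R =
      avoiding (omit x cs) I (removeAll x R) \<union> avoiding (contract x cs) (x # I) (removeAll x R)"
      (is "?A = ?B \<union> ?C")
    and "avoiding (omit x cs) I (removeAll x R)
      \<inter> avoiding (contract x cs) (x # I) (removeAll x R) = {}"
proof -
  have "Y \<in> ?A \<longleftrightarrow> Y \<in> ?B" if "x \<notin> Y" for Y
    using that assms by (auto simp: avoiding_def omit_def)
  moreover have "Y \<notin> ?C" if "x \<notin> Y" for Y
    using that by (simp add: avoiding_def)
  moreover have "Y \<notin> ?B" if "x \<in> Y" for Y
    using that assms by (auto simp: avoiding_def)
  moreover have "Y \<in> ?A \<longleftrightarrow> Y \<in> ?C" if "x \<in> Y" for Y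
  proof -
    have "(\<forall>c\<in>set cs. \<not> set c \<subseteq> Y) \<longleftrightarrow> (\<forall>c\<in>set (contract x cs). \<not> set c \<subseteq> Y)"
    proof -
      have "set (removeAll x c) \<subseteq> Y \<longleftrightarrow> set c \<subseteq> Y" for c using that by auto
      then show ?thesis
        by (simp del: set_removeAll add: contract_def omit_def ball_Un) blast
    qed
    moreover have "set I \<subseteq> Y \<and> Y \<subseteq> set I \<union> set R \<longleftrightarrow>
        set (x # I) \<subseteq> Y \<and> Y \<subseteq> set (x # I) \<union> set (removeAll x R)"
      using that assms by auto
    ultimately show ?thesis unfolding avoiding_def mem_Collect_eq by argo
  qed
  ultimately show "?A = ?B \<union> ?C" "?B \<inter> ?C = {}" by blast+
qed

lemma omit_measure:
  "sum_list (map length (omit x ((x # d) # cs))) < sum_list (map length ((x # d) # cs))"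
proof -
  have "sum_list (map length (omit x cs)) \<le> sum_list (map length cs)"
    by (induction cs) (auto simp: omit_def)
  then show ?thesis by (simp add: omit_def)
qed

lemma contract_measure:
  "sum_list (map length (contract x ((x # d) # cs))) < sum_list (map length ((x # d) # cs))"
proof -
  have le: "length (removeAll x c) \<le> length c" for c :: "'a list"
    by (simp add: removeAll_filter_not_eq)
  have "sum_list (map length (contract x cs)) \<le> sum_list (map length cs)"
  proof (induction cs)
    case (Cons c cs)
    from add_mono[OF le[of c] this] this show ?case
      by (cases "x \<in> set c") (simp_all add: contract_def omit_def add.assoc)
  qed (simp add: contract_def omit_def)
  from add_mono[OF le[of d] this] show ?thesis
    by (simp add: contract_def omit_def add.assoc less_Suc_eq_le)
qed

text \<open>
  Branching on an element of the first forbidden set cuts the family of avoiding sets into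
  intervals: no forbidden set is left over at a leaf, or one has become empty and the branch dies.
\<close>

function intervals :: "'a list list \<Rightarrow> 'a list \<Rightarrow> 'a list \<Rightarrow> ('a list \<times> 'a list) list" where
  "intervals [] I R = [(I, R)]"
| "intervals ([] # cs) I R = []"
| "intervals ((x # d) # cs) I R =
     intervals (omit x ((x # d) # cs)) I (removeAll x R) @
     intervals (contract x ((x # d) # cs)) (x # I) (removeAll x R)"
  by pat_completeness auto
termination
  by (relation "measure (\<lambda>(cs, I, R). sum_list (map length cs))")
    (simp, simp only: in_measure case_prod_conv omit_measure,
     simp only: in_measure case_prod_conv contract_measure)

definition interval_count :: "nat \<Rightarrow> 'a list \<times> 'a list \<Rightarrow> int" where
  "interval_count k = (\<lambda>(I, R). if length I \<le> k then pascal (length R) (k - length I) else 0)"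

lemma card_interval:
  assumes "distinct I" "distinct R" "set I \<inter> set R = {}"
  shows "int (card {Y. set I \<subseteq> Y \<and> Y \<subseteq> set I \<union> set R \<and> card Y = k}) = interval_count k (I, R)"
proof -
  let ?S = "{Z. Z \<subseteq> set R \<and> length I + card Z = k}"
  have card_Un: "card (set I \<union> Z) = length I + card Z" if "Z \<subseteq> set R" for Z
    using that assms by (subst card_Un_disjoint) (auto simp: distinct_card dest: finite_subset)
  have "{Y. set I \<subseteq> Y \<and> Y \<subseteq> set I \<union> set R \<and> card Y = k} = (\<union>) (set I) ` ?S" (is "?L = _")
  proof
    show "?L \<subseteq> (\<union>) (set I) ` ?S"
    proof
      fix Y assume Y: "Y \<in> ?L"
      then have "Y = set I \<union> (Y - set I)" "Y - set I \<subseteq> set R" by auto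
      with Y card_Un[of "Y - set I"] show "Y \<in> (\<union>) (set I) ` ?S" by (intro image_eqI) auto
    qed
  qed (auto simp: card_Un)
  moreover have "inj_on ((\<union>) (set I)) ?S"
    using assms(3) by (auto simp: inj_on_def)
  ultimately have "card ?L = card ?S" by (simp add: card_image)
  moreover have "?S = (if length I \<le> k then {Z. Z \<subseteq> set R \<and> card Z = k - length I} else {})"
    by auto
  ultimately show ?thesis
    using assms(2) by (simp add: interval_count_def pascal_eq_binomial n_subsets distinct_card)
qed

lemma card_avoiding:
  assumes "distinct I" "distinct R" "set I \<inter> set R = {}" "\<forall>c\<in>set cs. set c \<subseteq> set R"
  shows "int (card {Y \<in> avoiding cs I R. card Y = k})
    = sum_list (map (interval_count k) (intervals cs I R))"
  using assms
proof (induction cs I R rule: intervals.induct)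
  case (1 I R)
  then show ?case using card_interval[of I R k] by (simp add: avoiding_def conj_assoc)
next
  case (2 cs I R)
  then show ?case by (simp add: avoiding_def)
next
  case (3 x d cs I R)
  let ?cs = "(x # d) # cs" and ?R = "removeAll x R"
  let ?B = "{Y \<in> avoiding (omit x ?cs) I ?R. card Y = k}"
  let ?C = "{Y \<in> avoiding (contract x ?cs) (x # I) ?R. card Y = k}"
  have x: "x \<in> set R" "x \<notin> set I" using "3.prems"(3,4) by auto
  have fin: "finite (avoiding ds J S)" for ds :: "'a list list" and J S
    by (rule finite_subset[of _ "Pow (set J \<union> set S)"]) (auto simp: avoiding_def)
  have "{Y \<in> avoiding ?cs I R. card Y = k} = ?B \<union> ?C" "?B \<inter> ?C = {}"
    using avoiding_split[OF x, where cs = ?cs] by blast+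
  then have "card {Y \<in> avoiding ?cs I R. card Y = k} = card ?B + card ?C"
    using fin by (simp add: card_Un_disjoint)
  moreover have "int (card ?B) = sum_list (map (interval_count k) (intervals (omit x ?cs) I ?R))"
    using "3.prems" by (intro "3.IH"(1)) (auto simp: distinct_removeAll omit_def)
  moreover have "int (card ?C)
      = sum_list (map (interval_count k) (intervals (contract x ?cs) (x # I) ?R))"
    using "3.prems" x
    by (intro "3.IH"(2)) (auto simp: distinct_removeAll contract_def omit_def, blast)
  ultimately show ?case by simp
qed

text \<open>
  The same branching checks that every avoiding set lies below one of the sets in \<open>fs\<close>. Only the
  largest member \<open>I \<union> R\<close> of a leaf matters, and carrying along just those members of \<open>fs\<close> that
  contain \<open>I\<close> leaves few candidates to compare it with.
\<close>

function covered :: "'a list list \<Rightarrow> 'a list list \<Rightarrow> 'a list \<Rightarrow> bool" where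
  "covered [] fs R = (\<exists>f\<in>set fs. set R \<subseteq> set f)"
| "covered ([] # cs) fs R = True"
| "covered ((x # d) # cs) fs R = (
     covered (omit x ((x # d) # cs)) fs (removeAll x R) \<and>
     covered (contract x ((x # d) # cs)) (filter (\<lambda>f. x \<in> set f) fs) (removeAll x R))"
  by pat_completeness auto
termination
  by (relation "measure (\<lambda>(cs, fs, R). sum_list (map length cs))")
    (simp, simp only: in_measure case_prod_conv omit_measure,
     simp only: in_measure case_prod_conv contract_measure)

lemma covered_sound:
  assumes "covered cs fs R" "set I \<inter> set R = {}" "\<forall>c\<in>set cs. set c \<subseteq> set R"
    and "\<forall>f\<in>set fs. set I \<subseteq> set f" "Y \<in> avoiding cs I R"
  shows "\<exists>f\<in>set fs. Y \<subseteq> set f"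
  using assms
proof (induction cs fs R arbitrary: I rule: covered.induct)
  case (1 fs R)
  then show ?case by (fastforce simp: avoiding_def)
next
  case (2 cs fs R)
  then show ?case by (simp add: avoiding_def)
next
  case (3 x d cs fs R)
  let ?cs = "(x # d) # cs" and ?R = "removeAll x R"
  have x: "x \<in> set R" "x \<notin> set I" using "3.prems"(2,3) by auto
  with "3.prems"(5) consider "Y \<in> avoiding (omit x ?cs) I ?R"
    | "Y \<in> avoiding (contract x ?cs) (x # I) ?R"
    using avoiding_split(1)[OF x, of ?cs] by blast
  then show ?case
  proof cases
    case 1
    with "3.prems" show ?thesis
      by (intro "3.IH"(1)[of I]) (auto simp: omit_def)
  next
    case 2
    have "\<exists>f\<in>set (filter (\<lambda>f. x \<in> set f) fs). Y \<subseteq> set f"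
    proof (rule "3.IH"(2)[of "x # I"])
      show "\<forall>c\<in>set (contract x ?cs). set c \<subseteq> set ?R"
        using "3.prems"(3) by (fastforce simp: contract_def omit_def)
    qed (use "3.prems" 2 in auto)
    then show ?thesis by auto
  qed
qed

section \<open>Chords and rotations\<close>

text \<open>
  The short chords come first. The rotated chord sets below are listed in this order, so that the
  branching decides short chords early; with the lexicographic order the search is larger.
\<close>

definition chord_pairs :: "(nat \<times> nat) list" where
  "chord_pairs =
    [(0, 2), (0, 6), (1, 3), (1, 7), (2, 4), (3, 5), (4, 6), (5, 7),
     (0, 3), (0, 5), (1, 4), (1, 6), (2, 5), (2, 7), (3, 6), (4, 7),
     (0, 4), (1, 5), (2, 6), (3, 7)]"

lemma chord_pairs_less: "(i, j) \<in> set chord_pairs \<Longrightarrow> i < j \<and> j < 8"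
proof -
  have "\<forall>(i, j)\<in>set chord_pairs. i < j \<and> j < 8" by code_simp
  then show "(i, j) \<in> set chord_pairs \<Longrightarrow> i < j \<and> j < 8" by blast
qed

lemma distinct_chord_pairs: "distinct chord_pairs"
  by code_simp

lemma chords_eq: "chords = edge_set (set chord_pairs)"
proof
  show "chords \<subseteq> edge_set (set chord_pairs)"
  proof
    fix e assume "e \<in> chords"
    then obtain i j where e: "e = {i, j}" "i < 8" "j < 8" "i \<noteq> j" "{i, j} \<notin> edge_set (set cycle_pairs)"
      unfolding chords_def edges_C8 by (auto simp: verts_def C8_def)
    have "\<forall>i\<in>set [0..<8]. \<forall>j\<in>set [0..<8]. i = j
        \<or> (i, j) \<in> set cycle_pairs \<or> (j, i) \<in> set cycle_pairs
        \<or> (i, j) \<in> set chord_pairs \<or> (j, i) \<in> set chord_pairs"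
      by code_simp
    moreover have "i \<in> set [0..<8]" "j \<in> set [0..<8]" using e(2,3) by simp_all
    ultimately have "i = j \<or> (i, j) \<in> set cycle_pairs \<or> (j, i) \<in> set cycle_pairs
        \<or> (i, j) \<in> set chord_pairs \<or> (j, i) \<in> set chord_pairs"
      by blast
    with e show "e \<in> edge_set (set chord_pairs)"
      by (simp add: doubleton_in_edge_set)
  qed
  show "edge_set (set chord_pairs) \<subseteq> chords"
  proof
    fix e assume "e \<in> edge_set (set chord_pairs)"
    then obtain i j where ij: "(i, j) \<in> set chord_pairs" "e = {i, j}"
      by (auto simp: edge_set_def)
    have "\<forall>(i, j)\<in>set chord_pairs. i < 8 \<and> j < 8 \<and> i \<noteq> j
        \<and> (i, j) \<notin> set cycle_pairs \<and> (j, i) \<notin> set cycle_pairs"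
      by code_simp
    with ij(1) have "i < 8 \<and> j < 8 \<and> i \<noteq> j \<and> (i, j) \<notin> set cycle_pairs \<and> (j, i) \<notin> set cycle_pairs"
      by blast
    with ij(2) show "e \<in> chords"
      unfolding chords_def edges_C8
      by (intro CollectI exI[of _ i] exI[of _ j]) (simp add: doubleton_in_edge_set verts_def C8_def)
  qed
qed

lemma inj_on_edge_set: "inj_on (\<lambda>(a, b). {a, b}) (set chord_pairs)"
  by (auto simp: inj_on_def doubleton_eq_iff dest!: chord_pairs_less)

text \<open>
  A rotation is given by the list of its values, that is, as \<open>i \<mapsto> p ! i\<close>.
\<close>

definition rotations :: "nat list list" where
  "rotations = map (\<lambda>r. rotate r [0..<8]) [0..<8]"

definition image_pair :: "nat list \<Rightarrow> nat \<times> nat \<Rightarrow> nat \<times> nat" where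
  "image_pair p = (\<lambda>(a, b). if p ! a < p ! b then (p ! a, p ! b) else (p ! b, p ! a))"

text \<open>
  Besides sorting, \<open>chord_list\<close> would drop pairs that are no chords; a rotation maps chords to
  chords, so nothing is lost in the orbits (\<open>edge_set_rotated_chord_list\<close>).
\<close>

definition chord_list :: "(nat \<times> nat) list \<Rightarrow> (nat \<times> nat) list" where
  "chord_list es = filter (\<lambda>e. e \<in> set es) chord_pairs"

definition orbits :: "(nat \<times> nat) list list \<Rightarrow> (nat \<times> nat) list list" where
  "orbits cs = [chord_list (map (image_pair p) c). c \<leftarrow> cs, p \<leftarrow> rotations]"

lemma rotations_are_cycle_symmetries:
  assumes "p \<in> set rotations"
  shows "cycle_symmetry ((!) p)"
proof -
  have "\<forall>p\<in>set rotations. length p = 8 \<and> distinct p \<and> (\<forall>i\<in>set p. i < 8)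
      \<and> (\<forall>(a, b)\<in>set cycle_pairs. (p ! a, p ! b) \<in> set cycle_pairs \<or> (p ! b, p ! a) \<in> set cycle_pairs)"
    by code_simp
  with assms have p: "length p = 8" "distinct p" "set p \<subseteq> {..<8}"
    and e: "\<forall>(a, b)\<in>set cycle_pairs. (p ! a, p ! b) \<in> set cycle_pairs \<or> (p ! b, p ! a) \<in> set cycle_pairs"
    by auto
  have "set p = {..<8}"
    using p by (intro card_subset_eq) (simp_all add: distinct_card)
  then have "bij_betw ((!) p) {..<8} {..<8}"
    using p bij_betw_nth by metis
  moreover have "(!) p ` f \<in> edges C8" if "f \<in> edges C8" for f
  proof -
    from that obtain a b where ab: "(a, b) \<in> set cycle_pairs" "f = {a, b}"
      unfolding edges_C8 edge_set_def by auto
    with e have "(p ! a, p ! b) \<in> set cycle_pairs \<or> (p ! b, p ! a) \<in> set cycle_pairs" by blast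
    then show ?thesis
      unfolding edges_C8 using ab(2) by (simp add: doubleton_in_edge_set)
  qed
  ultimately show ?thesis
    by (simp add: cycle_symmetry_def verts_def C8_def)
qed

lemma rotations_inverse:
  assumes "p \<in> set rotations"
  obtains q where "q \<in> set rotations" "\<And>i. i < 8 \<Longrightarrow> q ! (p ! i) = i"
proof -
  have "\<forall>p\<in>set rotations. \<exists>q\<in>set rotations. \<forall>i\<in>set [0..<8]. q ! (p ! i) = i"
    by code_simp
  with assms that show thesis by auto
qed

lemma edge_set_rotated_chord_list:
  assumes "p \<in> set rotations" "set c \<subseteq> set chord_pairs"
  shows "edge_set (set (chord_list (map (image_pair p) c))) = (`) ((!) p) ` edge_set (set c)"
proof -
  have "\<forall>p\<in>set rotations. \<forall>e\<in>set chord_pairs. image_pair p e \<in> set chord_pairs"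
    by code_simp
  with assms have "set (chord_list (map (image_pair p) c)) = image_pair p ` set c"
    by (auto simp: chord_list_def)
  moreover have "edge_set (image_pair p ` set c) = (`) ((!) p) ` edge_set (set c)"
    unfolding edge_set_def image_image
    by (rule image_cong) (auto simp: image_pair_def split: if_splits)
  ultimately show ?thesis by simp
qed

lemma orbits_subset_chords: "\<forall>c\<in>set (orbits cs). set c \<subseteq> set chord_pairs"
  by (auto simp: orbits_def chord_list_def)

section \<open>Minimal non-faces and facets\<close>

text \<open>
  Representatives, up to rotation, of the minimal chord sets that kill everything, ordered by
  size so that the branching starts from the strongest constraints.
\<close>

definition killer_reps :: "(nat \<times> nat) list list" where
  "killer_reps =
    [[(0, 4), (1, 5)],
     [(0, 3), (1, 4)],
     [(0, 2), (1, 3)],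
     [(0, 2), (1, 4), (1, 5)],
     [(0, 2), (1, 6), (3, 7)],
     [(0, 2), (1, 5), (1, 6)],
     [(0, 2), (1, 5), (3, 6)],
     [(0, 3), (1, 6), (2, 5)],
     [(0, 2), (1, 5), (4, 7)],
     [(0, 2), (1, 4), (3, 7)],
     [(0, 2), (1, 4), (3, 5)],
     [(0, 2), (1, 4), (3, 6), (5, 7)],
     [(0, 2), (1, 5), (3, 7), (4, 6)],
     [(0, 2), (0, 6), (1, 5), (3, 7)],
     [(0, 2), (0, 6), (1, 5), (2, 4), (4, 6)],
     [(0, 2), (2, 7), (3, 6), (3, 7), (4, 6)],
     [(0, 2), (0, 3), (3, 7), (4, 6), (4, 7)]]"

text \<open>
  Representatives, up to rotation, of the maximal chord sets that leave something alive, rotated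
  such that \<open>{c\<^sub>0}\<close> is alive.
\<close>

definition survivor_reps :: "(nat \<times> nat) list list" where
  "survivor_reps =
    [[(0, 2), (0, 6), (1, 5), (4, 6)],
     [(0, 3), (0, 4), (0, 6), (1, 3), (4, 6), (4, 7)],
     [(0, 2), (0, 4), (0, 5), (1, 4), (2, 4), (5, 7)],
     [(0, 2), (0, 3), (0, 6), (3, 6), (3, 7), (4, 6)],
     [(0, 2), (0, 5), (0, 6), (2, 5), (2, 6), (2, 7), (3, 5)],
     [(0, 2), (0, 3), (0, 4), (0, 5), (2, 4), (2, 5), (5, 7)],
     [(0, 2), (0, 3), (0, 5), (0, 6), (1, 5), (2, 5), (3, 5)],
     [(0, 2), (0, 3), (0, 4), (0, 5), (2, 5), (3, 5), (5, 7)],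
     [(0, 2), (0, 4), (0, 5), (0, 6), (1, 4), (2, 4), (2, 6), (4, 6)],
     [(0, 2), (0, 3), (0, 4), (0, 6), (2, 4), (2, 6), (4, 6), (4, 7)],
     [(0, 2), (0, 3), (0, 4), (0, 5), (0, 6), (2, 5), (2, 6), (3, 5)],
     [(0, 2), (0, 3), (0, 4), (0, 5), (0, 6), (2, 6), (3, 5), (3, 6)],
     [(0, 2), (0, 3), (0, 4), (0, 5), (0, 6), (2, 4), (2, 5), (2, 6), (4, 6)],
     [(0, 2), (0, 3), (0, 4), (0, 5), (0, 6), (2, 4), (2, 6), (3, 6), (4, 6)]]"

text \<open>
  For the representatives, at every vertex \<open>v\<close> the enumeration meets two Hamiltonian paths from \<open>v\<close>
  with the same other end. For the rest of the orbit, an alive singleton could be rotated back.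
\<close>

lemma killer_not_leaves_alive:
  assumes "c \<in> set (orbits killer_reps)"
  shows "\<not> leaves_alive (edge_set (set c))"
proof -
  from assms obtain r p where r: "r \<in> set killer_reps" and p: "p \<in> set rotations"
    and c: "c = chord_list (map (image_pair p) r)"
    unfolding orbits_def by auto
  have "\<forall>r\<in>set killer_reps. (\<forall>e\<in>set r. e \<in> set chord_pairs)
      \<and> (\<forall>v\<in>set [0..<8]. \<not> distinct (map hd (extensions (cycle_pairs @ r) 7 [v])))"
    by code_simp
  with r have sub: "set r \<subseteq> set chord_pairs"
    and dup: "\<forall>v\<in>set [0..<8]. \<not> distinct (map hd (extensions (cycle_pairs @ r) 7 [v]))"
    by blast+
  have "set r \<subseteq> {..<8} \<times> {..<8}" using sub chord_pairs_less by force
  with dup have "\<not> leaves_alive (edge_set (set r))"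
    unfolding leaves_alive_def using kills_singleton_iff_extensions[of r]
    by (simp add: verts_def C8_def del: upt_conv_Cons upt_rec_numeral)
  then show ?thesis
    using leaves_alive_image[OF rotations_are_cycle_symmetries[OF p]]
    unfolding c edge_set_rotated_chord_list[OF p sub] by blast
qed

text \<open>
  Here one vertex is enough, and aliveness is brought to the rotated set by pulling it back along
  the inverse rotation \<open>q\<close>.
\<close>

lemma survivor_leaves_alive:
  assumes "f \<in> set (orbits survivor_reps)"
  shows "leaves_alive (edge_set (set f))"
proof -
  from assms obtain r p where r: "r \<in> set survivor_reps" and p: "p \<in> set rotations"
    and f: "f = chord_list (map (image_pair p) r)"
    unfolding orbits_def by auto
  have "\<forall>r\<in>set survivor_reps. (\<forall>e\<in>set r. e \<in> set chord_pairs)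
      \<and> distinct (map hd (extensions (cycle_pairs @ r) 7 [0]))"
    by code_simp
  with r have sub: "set r \<subseteq> set chord_pairs"
    and dist: "distinct (map hd (extensions (cycle_pairs @ r) 7 [0]))"
    by blast+
  have r8: "set r \<subseteq> {..<8} \<times> {..<8}" using sub chord_pairs_less by force
  with dist have "\<not> kills (edge_set (set r)) {0}"
    using kills_singleton_iff_extensions[of r 0] by simp
  then have alive: "leaves_alive (edge_set (set r))"
    unfolding leaves_alive_def by (auto simp: verts_def C8_def)
  obtain q where q: "q \<in> set rotations" "\<And>i. i < 8 \<Longrightarrow> q ! (p ! i) = i"
    using rotations_inverse[OF p] by blast
  have "(`) ((!) q) ` edge_set (set f) = (\<lambda>e. e) ` edge_set (set r)"
    unfolding f edge_set_rotated_chord_list[OF p sub] image_image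
  proof (rule image_cong[OF refl])
    fix e assume "e \<in> edge_set (set r)"
    with r8 have "e \<subseteq> {..<8}" by (auto simp: edge_set_def)
    then have "(\<lambda>i. q ! (p ! i)) ` e = (\<lambda>i. i) ` e"
      by (intro image_cong[OF refl]) (use q(2) in auto)
    then show "(\<lambda>x. q ! (p ! x)) ` e = e" by simp
  qed
  with alive show ?thesis
    using leaves_alive_image[OF rotations_are_cycle_symmetries[OF q(1)], of "edge_set (set f)"]
    by simp
qed

section \<open>The number of faces of each size\<close>

text \<open>
  The two lists are complete: whatever avoids all killers lies below a survivor.
\<close>

lemma avoiding_killers_covered: "covered (orbits killer_reps) (orbits survivor_reps) chord_pairs"
  by code_simp

text \<open>
  The list of intervals is an argument here, rather than being inlined, so that rewriting
  computes it once and not again for every size. The sizes run up to the total of \<open>20\<close> chords.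
\<close>

definition size_profile :: "('a list \<times> 'a list) list \<Rightarrow> int list" where
  "size_profile J = map (\<lambda>k. sum_list (map (interval_count k) J)) [0..<21]"

lemma size_profile_avoiding_killers:
  "size_profile (intervals (orbits killer_reps) [] chord_pairs)
   = [1, 20, 170, 736, 1654, 2036, 1474, 632, 152, 16] @ replicate 11 0"
  by code_simp

text \<open>
  Aliveness passes to smaller chord sets. So nothing is alive above a killer, and a chord set that
  avoids all killers has something alive because it lies below a survivor.
\<close>

lemma alive_chord_sets_eq:
  "alive_chord_sets = edge_set ` avoiding (orbits killer_reps) [] chord_pairs"
proof -
  let ?K = "orbits killer_reps"
  have alive: "leaves_alive (edge_set Y) \<longleftrightarrow> Y \<in> avoiding ?K [] chord_pairs"
    if Y: "Y \<subseteq> set chord_pairs" for Y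
  proof
    assume "leaves_alive (edge_set Y)"
    then have "\<not> set c \<subseteq> Y" if "c \<in> set ?K" for c
      using killer_not_leaves_alive[OF that] leaves_alive_antimono[of "edge_set Y" "edge_set (set c)"]
      by (auto simp: edge_set_def)
    then show "Y \<in> avoiding ?K [] chord_pairs"
      using Y by (simp add: avoiding_def)
  next
    assume "Y \<in> avoiding ?K [] chord_pairs"
    then obtain f where "f \<in> set (orbits survivor_reps)" "Y \<subseteq> set f"
      using covered_sound[OF avoiding_killers_covered, of "[]" Y] orbits_subset_chords[of killer_reps]
      by auto
    then show "leaves_alive (edge_set Y)"
      using survivor_leaves_alive[of f] leaves_alive_antimono[of "edge_set (set f)" "edge_set Y"]
      by (auto simp: edge_set_def)
  qed
  have "alive_chord_sets = {X. X \<subseteq> edge_set (set chord_pairs) \<and> leaves_alive X}"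
    by (simp add: alive_chord_sets_def leaves_alive_iff chords_eq)
  also have "\<dots> = edge_set ` {Y. Y \<subseteq> set chord_pairs \<and> leaves_alive (edge_set Y)}"
    unfolding edge_set_def by (auto simp: subset_image_iff)
  also have "{Y. Y \<subseteq> set chord_pairs \<and> leaves_alive (edge_set Y)} = avoiding ?K [] chord_pairs"
    using alive by (auto simp: avoiding_def)
  finally show ?thesis .
qed

lemma card_alive_chord_sets:
  "int (card {X \<in> alive_chord_sets. card X = k})
     = sum_list (map (interval_count k) (intervals (orbits killer_reps) [] chord_pairs))"
proof -
  let ?A = "avoiding (orbits killer_reps) [] chord_pairs"
  have sub: "Y \<subseteq> set chord_pairs" if "Y \<in> ?A" for Y
    using that by (simp add: avoiding_def)
  have card: "card (edge_set Y) = card Y" if "Y \<in> ?A" for Y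
    unfolding edge_set_def using inj_on_subset[OF inj_on_edge_set sub[OF that]] by (rule card_image)
  then have "{X \<in> alive_chord_sets. card X = k} = edge_set ` {Y \<in> ?A. card Y = k}"
    unfolding alive_chord_sets_eq by auto
  moreover have "inj_on edge_set {Y \<in> ?A. card Y = k}"
    using inj_on_image_Pow[OF inj_on_edge_set] sub unfolding edge_set_def
    by (auto intro: inj_on_subset)
  ultimately have "card {X \<in> alive_chord_sets. card X = k} = card {Y \<in> ?A. card Y = k}"
    by (simp add: card_image)
  then show ?thesis
    using card_avoiding[of "[]" chord_pairs "orbits killer_reps" k] distinct_chord_pairs
      orbits_subset_chords[of killer_reps] by simp
qed

theorem proposition7p12:
  shows "card (Pow chords) = 2 ^ 20
    \<and> card alive_chord_sets = 6891
    \<and> (\<forall>X\<in>alive_chord_sets. card X \<le> 9)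
    \<and> map (\<lambda>k. card {X \<in> alive_chord_sets. card X = k}) [0..<10]
        = [1, 20, 170, 736, 1654, 2036, 1474, 632, 152, 16]
    \<and> (\<forall>X. X \<subseteq> chords \<and> 10 \<le> card X \<longrightarrow> (\<forall>S\<in>admissible. kills X S))"
proof -
  let ?F = "\<lambda>k. {X \<in> alive_chord_sets. card X = k}"
  let ?counts = "[1, 20, 170, 736, 1654, 2036, 1474, 632, 152, 16] :: nat list"
  have fin: "finite chords" and card_chords: "card chords = 20"
  proof -
    show "finite chords" by (simp add: chords_eq edge_set_def)
    have "card chords = card (set chord_pairs)"
      unfolding chords_eq edge_set_def by (rule card_image[OF inj_on_edge_set])
    also have "\<dots> = 20"
      unfolding distinct_card[OF distinct_chord_pairs] by (simp add: chord_pairs_def)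
    finally show "card chords = 20" .
  qed
  have sub: "X \<subseteq> chords" if "X \<in> alive_chord_sets" for X
    using that by (simp add: alive_chord_sets_def)
  then have fin_alive: "finite alive_chord_sets"
    using fin by (intro finite_subset[of alive_chord_sets "Pow chords"]) auto
  have "map (\<lambda>k. int (card (?F k))) [0..<21] = map int ?counts @ replicate 11 0"
    using size_profile_avoiding_killers unfolding size_profile_def card_alive_chord_sets by simp
  moreover have "[0..<21] = [0..<10] @ [10..<21]"
    using upt_add_eq_append[of 0 10 11] by simp
  ultimately have split: "map (\<lambda>k. int (card (?F k))) [0..<10] @ map (\<lambda>k. int (card (?F k))) [10..<21]
      = map int ?counts @ replicate 11 0"
    by (simp only: map_append)
  have "length (map (\<lambda>k. int (card (?F k))) [0..<10]) = length (map int ?counts)" by simp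
  with split have counts: "map (\<lambda>k. int (card (?F k))) [0..<10] = map int ?counts"
    and above_9: "map (\<lambda>k. int (card (?F k))) [10..<21] = replicate 11 0"
    using append_eq_append_conv by blast+
  have "map int (map (\<lambda>k. card (?F k)) [0..<10]) = map int ?counts"
    unfolding map_map comp_def by (rule counts)
  then have counts: "map (\<lambda>k. card (?F k)) [0..<10] = ?counts"
    by (rule map_injective) (simp add: inj_def)
  have le_9: "card X \<le> 9" if X: "X \<in> alive_chord_sets" for X
  proof (rule ccontr)
    assume "\<not> card X \<le> 9"
    with card_mono[OF fin sub[OF X]] card_chords have "card X \<in> set [10..<21]"
      by (simp del: upt_rec_numeral upt_conv_Cons)
    then have "int (card (?F (card X))) \<in> set (map (\<lambda>k. int (card (?F k))) [10..<21])"
      unfolding set_map by (rule imageI)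
    then have "card (?F (card X)) = 0" unfolding above_9 by simp
    with X fin_alive show False by (auto simp: card_eq_0_iff)
  qed
  have "alive_chord_sets = (\<Union>k\<in>{0..<10}. ?F k)"
    using le_9 by fastforce
  also have "card \<dots> = (\<Sum>k\<in>{0..<10}. card (?F k))"
    using fin_alive by (intro card_UN_disjoint) auto
  also have "\<dots> = sum_list ?counts"
    unfolding counts[symmetric] interv_sum_list_conv_sum_set_nat set_upt ..
  finally have total: "card alive_chord_sets = 6891" by simp
  moreover have "kills X S" if "X \<subseteq> chords" "10 \<le> card X" "S \<in> admissible" for X S
  proof (rule ccontr)
    assume "\<not> kills X S"
    with that have "X \<in> alive_chord_sets" unfolding alive_chord_sets_def by blast
    with le_9[of X] that(2) show False by simp
  qed
  ultimately show ?thesis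
    using total le_9 counts fin card_chords by (simp add: card_Pow)
qed
end
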